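(* Thompson's quandle $P$ is isomorphic to the quandle defined by two generators $a$ and $b$ and the two relations $$a\rhd(a\rhd b)=b\rhd(a\rhd b),$$ $$a\rhd(a\rhd(a\rhd b))=b\rhd(a\rhd(a\rhd b)).$$
   Context: A quandle is a set $Q$ with a binary operation $\rhd$ such that for every $x\in Q$ the left multiplication $y\mapsto x\rhd y$ is bijective, $x\rhd(y\rhd z)=(x\rhd y)\rhd(x\rhd z)$ for all $x,y,z$, and $x\rhd x=x$ for all $x$. Quandles form an algebraic theory, so quandles may be defined by generators and relations. Thompson's quandle $P$ is the quandle with generators $p_0,p_1,p_2,\dots$ and relations $p_j\rhd p_k=p_{k+1}$ for all $0\leqslant j<k$. *)

theory Defs
  imports "HOL-Algebra.Congruence"
begin

section \<open>Quandles\<close>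

record 'a quandle_struct = "'a partial_object" +
  qop :: "'a \<Rightarrow> 'a \<Rightarrow> 'a" (infixr "\<rhd>\<index>" 70)

text \<open>Closure of the carrier under the operation is part of the bijectivity axiom.\<close>

locale quandle =
  fixes Q :: "('a, 'm) quandle_struct_scheme" (structure)
  assumes left_bij: "x \<in> carrier Q \<Longrightarrow> bij_betw (\<lambda>y. x \<rhd> y) (carrier Q) (carrier Q)"
    and self_distrib: "\<lbrakk>x \<in> carrier Q; y \<in> carrier Q; z \<in> carrier Q\<rbrakk>
      \<Longrightarrow> x \<rhd> (y \<rhd> z) = (x \<rhd> y) \<rhd> (x \<rhd> z)"
    and idem: "x \<in> carrier Q \<Longrightarrow> x \<rhd> x = x"

definition quandle_hom ::
  "('a, 'm) quandle_struct_scheme \<Rightarrow> ('b, 'n) quandle_struct_scheme \<Rightarrow> ('a \<Rightarrow> 'b) set" where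
  "quandle_hom Q Q' = {h. h \<in> carrier Q \<rightarrow> carrier Q' \<and>
     (\<forall>x\<in>carrier Q. \<forall>y\<in>carrier Q. h (x \<rhd>\<^bsub>Q\<^esub> y) = h x \<rhd>\<^bsub>Q'\<^esub> h y)}"

definition quandle_iso ::
  "('a, 'm) quandle_struct_scheme \<Rightarrow> ('b, 'n) quandle_struct_scheme \<Rightarrow> ('a \<Rightarrow> 'b) set" where
  "quandle_iso Q Q' = {h \<in> quandle_hom Q Q'. bij_betw h (carrier Q) (carrier Q')}"

definition quandle_isomorphic ::
  "('a, 'm) quandle_struct_scheme \<Rightarrow> ('b, 'n) quandle_struct_scheme \<Rightarrow> bool" where
  "quandle_isomorphic Q Q' \<longleftrightarrow> quandle_iso Q Q' \<noteq> {}"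

section \<open>Generators and relations\<close>

text \<open>Quandles become an algebraic theory once the inverses of the left multiplications are
  included among the operations: the term \<open>Inv s t\<close> stands for the unique \<open>u\<close> with
  \<open>s \<rhd> u = t\<close>.\<close>

datatype 'g qterm =
    Gen 'g
  | Op "'g qterm" "'g qterm" (infixr "\<triangleright>" 70)
  | Inv "'g qterm" "'g qterm"

inductive qcong :: "('g qterm \<times> 'g qterm) set \<Rightarrow> 'g qterm \<Rightarrow> 'g qterm \<Rightarrow> bool"
  for R :: "('g qterm \<times> 'g qterm) set" where
  rel: "(s, t) \<in> R \<Longrightarrow> qcong R s t"
| refl: "qcong R s s"
| sym: "qcong R s t \<Longrightarrow> qcong R t s"
| trans: "qcong R s t \<Longrightarrow> qcong R t u \<Longrightarrow> qcong R s u"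
| cong_Op: "qcong R s s' \<Longrightarrow> qcong R t t' \<Longrightarrow> qcong R (s \<triangleright> t) (s' \<triangleright> t')"
| cong_Inv: "qcong R s s' \<Longrightarrow> qcong R t t' \<Longrightarrow> qcong R (Inv s t) (Inv s' t')"
| Op_Inv: "qcong R (s \<triangleright> Inv s t) t"
| Inv_Op: "qcong R (Inv s (s \<triangleright> t)) t"
| distrib: "qcong R (s \<triangleright> (t \<triangleright> u)) ((s \<triangleright> t) \<triangleright> (s \<triangleright> u))"
| idem: "qcong R (s \<triangleright> s) s"

definition qcong_rel :: "('g qterm \<times> 'g qterm) set \<Rightarrow> ('g qterm \<times> 'g qterm) set" where
  "qcong_rel R = {(s, t). qcong R s t}"

text \<open>The quandle with generators indexed by the type \<open>'g\<close> and relations \<open>s = t\<close> for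
  \<open>(s, t) \<in> R\<close>.\<close>

definition presented_quandle ::
  "('g qterm \<times> 'g qterm) set \<Rightarrow> 'g qterm set quandle_struct" where
  "presented_quandle R =
     \<lparr>carrier = UNIV // qcong_rel R,
      qop = (\<lambda>X Y. \<Union>s\<in>X. \<Union>t\<in>Y. qcong_rel R `` {s \<triangleright> t})\<rparr>"

lemma equiv_qcong_rel: "equiv UNIV (qcong_rel R)"
  unfolding qcong_rel_def
  by (rule equivI) (auto intro!: refl_onI symI transI intro: qcong.intros)

lemma class_eq_iff: "qcong_rel R `` {s} = qcong_rel R `` {t} \<longleftrightarrow> qcong R s t"
  using eq_equiv_class_iff[OF equiv_qcong_rel, of s t R] by (simp add: qcong_rel_def)

lemma carrier_presented: "carrier (presented_quandle R) = range (\<lambda>s. qcong_rel R `` {s})"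
  by (auto simp: presented_quandle_def quotient_def)

lemma qop_presented:
  "(qcong_rel R `` {s}) \<rhd>\<^bsub>presented_quandle R\<^esub> (qcong_rel R `` {t}) = qcong_rel R `` {s \<triangleright> t}"
proof -
  have "congruent2 (qcong_rel R) (qcong_rel R) (\<lambda>s t. qcong_rel R `` {s \<triangleright> t})"
    unfolding congruent2_def by (auto simp: class_eq_iff) (auto simp: qcong_rel_def intro: qcong.cong_Op)
  from UN_equiv_class2[OF equiv_qcong_rel equiv_qcong_rel this, of s t] show ?thesis
    by (simp add: presented_quandle_def)
qed

lemma quandle_presented: "quandle (presented_quandle R)"
proof
  fix x assume "x \<in> carrier (presented_quandle R)"
  then obtain s where s: "x = qcong_rel R `` {s}" by (auto simp: carrier_presented)
  show "bij_betw (\<lambda>y. x \<rhd>\<^bsub>presented_quandle R\<^esub> y)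
      (carrier (presented_quandle R)) (carrier (presented_quandle R))"
  proof (rule bij_betw_imageI)
    show "inj_on (\<lambda>y. x \<rhd>\<^bsub>presented_quandle R\<^esub> y) (carrier (presented_quandle R))"
    proof (rule inj_onI, clarsimp simp: carrier_presented s qop_presented class_eq_iff)
      fix t u assume "qcong R (s \<triangleright> t) (s \<triangleright> u)"
      then have "qcong R (Inv s (s \<triangleright> t)) (Inv s (s \<triangleright> u))"
        by (rule qcong.cong_Inv[OF qcong.refl])
      then show "qcong R t u"
        using qcong.Inv_Op qcong.sym qcong.trans by metis
    qed
    have "qcong_rel R `` {t} = qcong_rel R `` {s \<triangleright> Inv s t}" for t
      by (simp add: class_eq_iff qcong.sym[OF qcong.Op_Inv])
    then show "(\<lambda>y. x \<rhd>\<^bsub>presented_quandle R\<^esub> y) ` carrier (presented_quandle R)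
        = carrier (presented_quandle R)"
      by (auto simp: carrier_presented s qop_presented image_image)
  qed
next
  fix x y z
  assume "x \<in> carrier (presented_quandle R)" "y \<in> carrier (presented_quandle R)"
    "z \<in> carrier (presented_quandle R)"
  then obtain s t u where "x = qcong_rel R `` {s}" "y = qcong_rel R `` {t}" "z = qcong_rel R `` {u}"
    by (auto simp only: carrier_presented)
  then show "x \<rhd>\<^bsub>presented_quandle R\<^esub> (y \<rhd>\<^bsub>presented_quandle R\<^esub> z)
      = (x \<rhd>\<^bsub>presented_quandle R\<^esub> y) \<rhd>\<^bsub>presented_quandle R\<^esub>
        (x \<rhd>\<^bsub>presented_quandle R\<^esub> z)"
    by (simp only: qop_presented class_eq_iff qcong.distrib)
next
  fix x assume "x \<in> carrier (presented_quandle R)"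
  then obtain s where "x = qcong_rel R `` {s}" by (auto simp only: carrier_presented)
  then show "x \<rhd>\<^bsub>presented_quandle R\<^esub> x = x"
    by (simp only: qop_presented class_eq_iff qcong.idem)
qed

text \<open>Evaluation of terms in a quandle, and the universal property of
  \<^const>\<open>presented_quandle\<close>.\<close>

primrec qeval :: "('a, 'm) quandle_struct_scheme \<Rightarrow> ('g \<Rightarrow> 'a) \<Rightarrow> 'g qterm \<Rightarrow> 'a" where
  "qeval Q f (Gen g) = f g"
| "qeval Q f (s \<triangleright> t) = qeval Q f s \<rhd>\<^bsub>Q\<^esub> qeval Q f t"
| "qeval Q f (Inv s t) = inv_into (carrier Q) (\<lambda>y. qeval Q f s \<rhd>\<^bsub>Q\<^esub> y) (qeval Q f t)"

lemma (in quandle) qeval_closed: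
  assumes "range f \<subseteq> carrier Q"
  shows "qeval Q f s \<in> carrier Q"
proof (induction s)
  case (Gen g) then show ?case using assms by auto
next
  case (Op s t) then show ?case using bij_betwE[OF left_bij] by simp
next
  case (Inv s t) then show ?case
    using bij_betw_imp_surj_on[OF left_bij[OF Inv(1)]] by (simp add: inv_into_into)
qed

lemma (in quandle) qeval_qcong:
  assumes f: "range f \<subseteq> carrier Q"
    and R: "\<And>s t. (s, t) \<in> R \<Longrightarrow> qeval Q f s = qeval Q f t"
    and "qcong R s t"
  shows "qeval Q f s = qeval Q f t"
  using assms(3)
proof induction
  case (Op_Inv s t)
  show ?case
    using bij_betw_inv_into_right[OF left_bij[OF qeval_closed[OF f]] qeval_closed[OF f]] by simp
next
  case (Inv_Op s t)
  show ?case
    using bij_betw_inv_into_left[OF left_bij[OF qeval_closed[OF f]] qeval_closed[OF f]] by simp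
qed (auto simp: R qeval_closed[OF f] intro: self_distrib idem)

lemma presented_quandle_relations:
  "(s, t) \<in> R \<Longrightarrow> qcong_rel R `` {s} = qcong_rel R `` {t}"
  by (simp add: class_eq_iff qcong.rel)

theorem (in quandle) presented_quandle_universal:
  assumes f: "range f \<subseteq> carrier Q"
    and R: "\<And>s t. (s, t) \<in> R \<Longrightarrow> qeval Q f s = qeval Q f t"
  shows "\<exists>h \<in> quandle_hom (presented_quandle R) Q. \<forall>g. h (qcong_rel R `` {Gen g}) = f g"
    and "\<lbrakk>h \<in> quandle_hom (presented_quandle R) Q; \<forall>g. h (qcong_rel R `` {Gen g}) = f g;
          h' \<in> quandle_hom (presented_quandle R) Q; \<forall>g. h' (qcong_rel R `` {Gen g}) = f g;
          x \<in> carrier (presented_quandle R)\<rbrakk> \<Longrightarrow> h x = h' x"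
proof -
  define k where "k X = qeval Q f (SOME s. s \<in> X)" for X
  have k: "k (qcong_rel R `` {s}) = qeval Q f s" for s
  proof -
    have "s \<in> qcong_rel R `` {s}" by (simp add: qcong_rel_def qcong.refl)
    then have "(SOME t. t \<in> qcong_rel R `` {s}) \<in> qcong_rel R `` {s}" by (rule someI)
    then have "qcong R s (SOME t. t \<in> qcong_rel R `` {s})" by (simp add: qcong_rel_def)
    from qeval_qcong[OF f R this] show ?thesis by (simp add: k_def)
  qed
  have "k \<in> quandle_hom (presented_quandle R) Q"
    by (auto simp: quandle_hom_def carrier_presented qop_presented k qeval_closed[OF f])
  then show "\<exists>h \<in> quandle_hom (presented_quandle R) Q. \<forall>g. h (qcong_rel R `` {Gen g}) = f g"
    using k by (intro bexI[of _ k]) auto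
next
  have *: "h (qcong_rel R `` {s}) = qeval Q f s"
    if h: "h \<in> quandle_hom (presented_quandle R) Q" "\<forall>g. h (qcong_rel R `` {Gen g}) = f g" for h s
  proof (induction s)
    case (Gen g) then show ?case using h by simp
  next
    case (Op s t)
    have "h (qcong_rel R `` {s \<triangleright> t}) = h (qcong_rel R `` {s}) \<rhd> h (qcong_rel R `` {t})"
      using h(1) unfolding quandle_hom_def by (auto simp: carrier_presented qop_presented[symmetric])
    then show ?case using Op by simp
  next
    case (Inv s t)
    have "h (qcong_rel R `` {s \<triangleright> Inv s t})
        = h (qcong_rel R `` {s}) \<rhd> h (qcong_rel R `` {Inv s t})"
      using h(1) unfolding quandle_hom_def by (auto simp: carrier_presented qop_presented[symmetric])
    moreover have "qcong_rel R `` {s \<triangleright> Inv s t} = qcong_rel R `` {t}"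
      by (simp add: class_eq_iff qcong.Op_Inv)
    ultimately have eq: "qeval Q f t = qeval Q f s \<rhd> h (qcong_rel R `` {Inv s t})"
      using Inv by simp
    have "h (qcong_rel R `` {Inv s t}) \<in> carrier Q"
      using h(1) unfolding quandle_hom_def by (auto simp: carrier_presented)
    from bij_betw_inv_into_left[OF left_bij[OF qeval_closed[OF f]] this]
    show ?case using eq by simp
  qed
  show "\<lbrakk>h \<in> quandle_hom (presented_quandle R) Q; \<forall>g. h (qcong_rel R `` {Gen g}) = f g;
      h' \<in> quandle_hom (presented_quandle R) Q; \<forall>g. h' (qcong_rel R `` {Gen g}) = f g;
      x \<in> carrier (presented_quandle R)\<rbrakk> \<Longrightarrow> h x = h' x"
    using *[of h] *[of h'] by (auto simp: carrier_presented)
qed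

section \<open>Thompson's quandle\<close>

definition thompson_quandle :: "nat qterm set quandle_struct" where
  "thompson_quandle = presented_quandle {(Gen j \<triangleright> Gen k, Gen (k + 1)) | j k. j < k}"

datatype gen2 = gen_a | gen_b

end

theory Submission
  imports Defs
begin

text \<open>Thompson's quandle is generated by \<open>p\<^sub>0\<close> and \<open>p\<^sub>1\<close>, since \<open>p\<^sub>k\<^sub>+\<^sub>1 = p\<^sub>0 \<rhd> p\<^sub>k\<close> for \<open>k \<ge> 1\<close>. Written in
  terms of \<open>a = p\<^sub>0\<close> and \<open>b = p\<^sub>1\<close>, the two relations of the finite presentation say
  \<open>p\<^sub>1 \<rhd> p\<^sub>2 = p\<^sub>3\<close> and \<open>p\<^sub>1 \<rhd> p\<^sub>3 = p\<^sub>4\<close>, where the right-hand sides are \<open>a \<rhd> p\<^sub>2\<close> and \<open>a \<rhd> p\<^sub>3\<close>.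
  The point is that these two instances imply all the relations \<open>p\<^sub>j \<rhd> p\<^sub>k = p\<^sub>k\<^sub>+\<^sub>1\<close>.

  Left multiplication by \<open>a\<close> is an endomorphism, so a relation for \<open>(1, 1 + d)\<close> can be shifted to
  one for \<open>(j, j + d)\<close> for every \<open>j \<ge> 1\<close>. It remains to reach every gap \<open>d\<close>, which goes by
  induction: for \<open>d \<ge> 3\<close>,
  \<open>p\<^sub>1 \<rhd> p\<^sub>d\<^sub>+\<^sub>1 = p\<^sub>1 \<rhd> (p\<^sub>2 \<rhd> p\<^sub>d) = (p\<^sub>1 \<rhd> p\<^sub>2) \<rhd> (p\<^sub>1 \<rhd> p\<^sub>d) = p\<^sub>3 \<rhd> p\<^sub>d\<^sub>+\<^sub>1 = p\<^sub>d\<^sub>+\<^sub>2\<close>,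
  where only the gaps \<open>d - 2\<close>, \<open>1\<close>, \<open>d - 1\<close> and again \<open>d - 2\<close> occur; this is lemma
  \<open>thompson_relations_from_two\<close>. The universal property then gives homomorphisms in both directions
  which are mutually inverse on generators, hence mutually inverse.\<close>

lemma (in quandle) thompson_relations_from_two:
  fixes p :: "nat \<Rightarrow> 'a"
  assumes closed: "\<And>n. p n \<in> carrier Q"
    and p0: "\<And>k. 0 < k \<Longrightarrow> p 0 \<rhd> p k = p (k + 1)"
    and p12: "p 1 \<rhd> p 2 = p 3"
    and p13: "p 1 \<rhd> p 3 = p 4"
    and "j < k"
  shows "p j \<rhd> p k = p (k + 1)"
proof -
  \<comment> \<open>Left multiplication by \<open>p 0\<close> shifts a relation along the sequence.\<close>
  have shift: "p (i + 1) \<rhd> p (i + 1 + d) = p (i + 2 + d)"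
    if "p 1 \<rhd> p (1 + d) = p (2 + d)" for i d
  proof (induction i)
    case 0 then show ?case using that by simp
  next
    case (Suc i)
    have "p 0 \<rhd> p (i + 2 + d) = (p 0 \<rhd> p (i + 1)) \<rhd> (p 0 \<rhd> p (i + 1 + d))"
      unfolding Suc[symmetric] by (rule self_distrib) (rule closed)+
    then show ?case by (simp add: p0)
  qed
  have gap: "p 1 \<rhd> p (1 + d) = p (2 + d)" if "0 < d" for d
    using that
  proof (induction d rule: less_induct)
    case (less d)
    consider "d = 1" | "d = 2" | "3 \<le> d" using less.prems by linarith
    then show ?case
    proof cases
      case 1 then show ?thesis using p12 by (simp add: numeral_eq_Suc)
    next
      case 2 then show ?thesis using p13 by (simp add: numeral_eq_Suc)
    next
      case 3
      define e where "e = d - 3"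
      have d: "d = e + 3" using 3 by (simp add: e_def)
      have "p 1 \<rhd> p (1 + (e + 1)) = p (2 + (e + 1))"
        by (rule less.IH) (simp_all add: d)
      from shift[OF this] have short: "p (i + 1) \<rhd> p (i + e + 2) = p (i + e + 3)" for i
        by (simp add: numeral_eq_Suc)
      have long: "p 1 \<rhd> p (e + 3) = p (e + 4)"
        using less.IH[of "e + 2"] by (simp add: d numeral_eq_Suc)
      have "p 1 \<rhd> p (e + 4) = p 1 \<rhd> (p 2 \<rhd> p (e + 3))"
        using short[of 1] by (simp add: numeral_eq_Suc)
      also have "\<dots> = (p 1 \<rhd> p 2) \<rhd> (p 1 \<rhd> p (e + 3))"
        by (rule self_distrib) (rule closed)+
      also have "\<dots> = p 3 \<rhd> p (e + 4)" by (simp only: p12 long)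
      also have "\<dots> = p (e + 5)" using short[of 2] by (simp add: numeral_eq_Suc)
      finally show ?thesis by (simp add: d numeral_eq_Suc)
    qed
  qed
  show ?thesis
  proof (cases j)
    case 0 then show ?thesis using \<open>j < k\<close> p0 by simp
  next
    case (Suc i)
    then obtain d where "0 < d" "k = i + 1 + d"
      using \<open>j < k\<close> less_imp_add_positive[of j k] by auto
    then show ?thesis using shift[OF gap] Suc by simp
  qed
qed

lemma quandle_hom_closed:
  "h \<in> quandle_hom Q Q' \<Longrightarrow> x \<in> carrier Q \<Longrightarrow> h x \<in> carrier Q'"
  by (auto simp: quandle_hom_def)

lemma quandle_hom_op:
  "h \<in> quandle_hom Q Q' \<Longrightarrow> x \<in> carrier Q \<Longrightarrow> y \<in> carrier Q
    \<Longrightarrow> h (x \<rhd>\<^bsub>Q\<^esub> y) = h x \<rhd>\<^bsub>Q'\<^esub> h y"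
  by (auto simp: quandle_hom_def)

lemma class_in_carrier: "qcong_rel R `` {s} \<in> carrier (presented_quandle R)"
  by (auto simp: carrier_presented)

text \<open>A homomorphism preserves the inverse operation as well, because its target has injective
  left multiplications; so it is determined by its values on the generators.\<close>

lemma (in quandle) presented_quandle_hom_eqI:
  assumes h: "h \<in> quandle_hom (presented_quandle R) Q"
    and k: "k \<in> quandle_hom (presented_quandle R) Q"
    and gens: "\<And>g. h (qcong_rel R `` {Gen g}) = k (qcong_rel R `` {Gen g})"
    and "x \<in> carrier (presented_quandle R)"
  shows "h x = k x"
proof -
  have op: "f (qcong_rel R `` {s \<triangleright> t}) = f (qcong_rel R `` {s}) \<rhd> f (qcong_rel R `` {t})"
    if "f \<in> quandle_hom (presented_quandle R) Q" for f s t
    using quandle_hom_op[OF that class_in_carrier class_in_carrier] by (simp only: qop_presented)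
  have "h (qcong_rel R `` {s}) = k (qcong_rel R `` {s})" for s
  proof (induction s)
    case (Gen g) show ?case by (rule gens)
  next
    case (Op s t) then show ?case by (simp only: op[OF h] op[OF k])
  next
    case (Inv s t)
    have "qcong_rel R `` {s \<triangleright> Inv s t} = qcong_rel R `` {t}"
      by (simp add: class_eq_iff qcong.Op_Inv)
    then have "k (qcong_rel R `` {s}) \<rhd> h (qcong_rel R `` {Inv s t})
        = k (qcong_rel R `` {s}) \<rhd> k (qcong_rel R `` {Inv s t})"
      using Inv by (metis op[OF h] op[OF k])
    then show ?case
      using bij_betw_imp_inj_on[OF left_bij[OF quandle_hom_closed[OF k class_in_carrier[of R s]]]]
        quandle_hom_closed[OF h class_in_carrier] quandle_hom_closed[OF k class_in_carrier]
      by (meson inj_onD)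
  qed
  then show ?thesis using \<open>x \<in> carrier (presented_quandle R)\<close> by (auto simp: carrier_presented)
qed

lemma presented_quandles_isomorphicI:
  assumes h: "h \<in> quandle_hom (presented_quandle R) (presented_quandle S)"
    and k: "k \<in> quandle_hom (presented_quandle S) (presented_quandle R)"
    and kh: "\<And>g. k (h (qcong_rel R `` {Gen g})) = qcong_rel R `` {Gen g}"
    and hk: "\<And>g. h (k (qcong_rel S `` {Gen g})) = qcong_rel S `` {Gen g}"
  shows "quandle_isomorphic (presented_quandle R) (presented_quandle S)"
proof -
  have id: "id \<in> quandle_hom (presented_quandle T) (presented_quandle T)"
    for T :: "('c qterm \<times> 'c qterm) set"
    by (simp add: quandle_hom_def)
  have "k \<circ> h \<in> quandle_hom (presented_quandle R) (presented_quandle R)"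
    using h k by (auto simp: quandle_hom_def Pi_iff)
  from quandle.presented_quandle_hom_eqI[OF quandle_presented this id] kh
  have "k (h x) = x" if "x \<in> carrier (presented_quandle R)" for x
    using that by simp
  moreover have "h \<circ> k \<in> quandle_hom (presented_quandle S) (presented_quandle S)"
    using h k by (auto simp: quandle_hom_def Pi_iff)
  from quandle.presented_quandle_hom_eqI[OF quandle_presented this id] hk
  have "h (k y) = y" if "y \<in> carrier (presented_quandle S)" for y
    using that by simp
  ultimately have "bij_betw h (carrier (presented_quandle R)) (carrier (presented_quandle S))"
    using quandle_hom_closed[OF h] quandle_hom_closed[OF k]
    by (intro bij_betw_byWitness[where f' = k]) auto
  then show ?thesis using h by (auto simp: quandle_isomorphic_def quandle_iso_def)
qed

theorem proposition5p1:
  "quandle_isomorphic thompson_quandle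
     (presented_quandle
       {(Gen gen_a \<triangleright> (Gen gen_a \<triangleright> Gen gen_b), Gen gen_b \<triangleright> (Gen gen_a \<triangleright> Gen gen_b)),
        (Gen gen_a \<triangleright> (Gen gen_a \<triangleright> (Gen gen_a \<triangleright> Gen gen_b)), Gen gen_b \<triangleright> (Gen gen_a \<triangleright> (Gen gen_a \<triangleright> Gen gen_b)))})"
  (is "quandle_isomorphic _ (presented_quandle ?S)")
proof -
  define R :: "(nat qterm \<times> nat qterm) set"
    where "R = {(Gen j \<triangleright> Gen k, Gen (k + 1)) | j k. j < k}"
  define S where "S = ?S"
  interpret P: quandle "presented_quandle R" by (rule quandle_presented)
  interpret F: quandle "presented_quandle S" by (rule quandle_presented)
  define q where "q n = qcong_rel R `` {Gen n}" for n
  define c where "c g = qcong_rel S `` {Gen g}" for g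
  have q_closed: "q n \<in> carrier (presented_quandle R)" for n
    unfolding q_def by (rule class_in_carrier)
  have c_closed: "c g \<in> carrier (presented_quandle S)" for g
    unfolding c_def by (rule class_in_carrier)
  have q_rel: "q j \<rhd>\<^bsub>presented_quandle R\<^esub> q k = q (Suc k)" if "j < k" for j k
    unfolding q_def qop_presented
    by (rule presented_quandle_relations) (use that in \<open>auto simp: R_def\<close>)
  have F_op: "x \<rhd>\<^bsub>presented_quandle S\<^esub> y \<in> carrier (presented_quandle S)"
    if "x \<in> carrier (presented_quandle S)" "y \<in> carrier (presented_quandle S)" for x y
    using bij_betwE[OF F.left_bij] that by blast

  define p where "p n = (case n of 0 \<Rightarrow> c gen_a
    | Suc k \<Rightarrow> ((\<lambda>y. c gen_a \<rhd>\<^bsub>presented_quandle S\<^esub> y) ^^ k) (c gen_b))" for n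
  have p0: "p 0 = c gen_a" and p1: "p (Suc 0) = c gen_b"
    and pSuc: "p (Suc (Suc n)) = c gen_a \<rhd>\<^bsub>presented_quandle S\<^esub> p (Suc n)" for n
    by (simp_all add: p_def)
  have p_closed: "p n \<in> carrier (presented_quandle S)" for n
  proof (induction n rule: induct_nat_012)
    case (ge2 n) then show ?case unfolding pSuc by (intro F_op c_closed)
  qed (simp_all add: p0 p1 c_closed)
  have p_rel: "p j \<rhd>\<^bsub>presented_quandle S\<^esub> p k = p (Suc k)" if "j < k" for j k
  proof -
    have "p 0 \<rhd>\<^bsub>presented_quandle S\<^esub> p k = p (k + 1)" if "0 < k" for k
      using that by (cases k) (simp_all add: p0 pSuc)
    moreover have "p 1 \<rhd>\<^bsub>presented_quandle S\<^esub> p 2 = p 3"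
      "p 1 \<rhd>\<^bsub>presented_quandle S\<^esub> p 3 = p 4"
      unfolding numeral_eq_Suc pred_numeral_simps One_nat_def BitM.simps p1 pSuc
      by (unfold c_def qop_presented, (rule presented_quandle_relations[symmetric], simp add: S_def)+)
    ultimately show ?thesis
      using F.thompson_relations_from_two[of p j k] p_closed that by simp
  qed

  have "\<exists>h \<in> quandle_hom (presented_quandle R) (presented_quandle S).
      \<forall>n. h (qcong_rel R `` {Gen n}) = p n"
    by (rule F.presented_quandle_universal(1)) (auto simp: R_def p_closed p_rel)
  then obtain h where h: "h \<in> quandle_hom (presented_quandle R) (presented_quandle S)"
    and h_gen: "\<And>n. h (q n) = p n" unfolding q_def by blast
  define f where "f g = (case g of gen_a \<Rightarrow> q 0 | gen_b \<Rightarrow> q (Suc 0))" for g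
  have "\<exists>k \<in> quandle_hom (presented_quandle S) (presented_quandle R).
      \<forall>g. k (qcong_rel S `` {Gen g}) = f g"
    by (rule P.presented_quandle_universal(1))
      (auto simp: S_def f_def q_closed q_rel split: gen2.splits)
  then obtain k where k: "k \<in> quandle_hom (presented_quandle S) (presented_quandle R)"
    and k_gen: "\<And>g. k (c g) = f g" unfolding c_def by blast

  have kp: "k (p n) = q n" for n
  proof (induction n rule: induct_nat_012)
    case (ge2 n)
    then show ?case
      by (simp add: pSuc quandle_hom_op[OF k c_closed p_closed] k_gen f_def q_rel)
  qed (simp_all add: p0 p1 k_gen f_def)
  have "h (k (c g)) = c g" for g
    by (cases g) (simp_all add: k_gen f_def h_gen p0 p1)
  then have "quandle_isomorphic (presented_quandle R) (presented_quandle S)"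
    using presented_quandles_isomorphicI[OF h k] h_gen kp unfolding q_def c_def by simp
  then show ?thesis unfolding R_def S_def thompson_quandle_def .
qed

end
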